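(* Let $q \geq 1$ be an integer and let $\chi$ be a non-principal Dirichlet character modulo $q$. Then $$|L(1+it,\chi)| < \log\left(t+\tfrac{14}{5}\right) + \log q + 1$$ for all real $t > 0$.
   Context: $L(s,\chi)=\sum_{n\ge 1}\chi(n)n^{-s}$ is the Dirichlet $L$-function of $\chi$, defined by this series for $\mathrm{Re}(s)>1$ and by analytic continuation elsewhere (for non-principal $\chi$ the series also converges for $\mathrm{Re}(s)>0$). *)

theory Defs
  imports "HOL-Complex_Analysis.Complex_Analysis"
begin

definition dirichlet_character :: "nat \<Rightarrow> (int \<Rightarrow> complex) \<Rightarrow> bool" where
  "dirichlet_character q X \<longleftrightarrow>
     (\<forall>m n. X (m * n) = X m * X n) \<and>
     (\<forall>n. X (n + int q) = X n) \<and>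
     (\<forall>n. X n \<noteq> 0 \<longleftrightarrow> coprime n (int q))"

definition principal_character :: "nat \<Rightarrow> int \<Rightarrow> complex" where
  "principal_character q n = (if coprime n (int q) then 1 else 0)"

(* The summation index is shifted so that the sum runs over n + 1 = 1, 2, 3, ...
   The value is only meaningful where the series converges. *)
definition dirichlet_series :: "(int \<Rightarrow> complex) \<Rightarrow> complex \<Rightarrow> complex" where
  "dirichlet_series X s = (\<Sum>n. X (int (Suc n)) * of_nat (Suc n) powr (- s))"

(* Analytic continuation of the series from Re z > 1. The regions used are the
   half-planes Re z > a, with the point 1 either kept or removed; the removal is
   needed for principal characters, where L has a pole at 1. Any two such regions
   meet in a connected set that contains points with Re z > 1, so w is unique
   (Dirichlet_L_eqI); as a decreases the regions exhaust the whole plane. *)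
definition Dirichlet_L :: "complex \<Rightarrow> (int \<Rightarrow> complex) \<Rightarrow> complex" where
  "Dirichlet_L s X =
     (THE w. \<exists>a P f. P \<subseteq> {1} \<and> s \<in> {z. a < Re z} - P \<and>
        f holomorphic_on ({z. a < Re z} - P) \<and>
        (\<forall>z \<in> {z. a < Re z} - P. Re z > 1 \<longrightarrow> f z = dirichlet_series X z) \<and>
        w = f s)"

lemma halfplane_continuation_unique:
  fixes f g :: "complex \<Rightarrow> complex" and a b :: real
  assumes "P \<subseteq> {1}" "s \<in> {z. a < Re z} - P" "f holomorphic_on ({z. a < Re z} - P)"
    and f: "\<And>z. z \<in> {z. a < Re z} - P \<Longrightarrow> Re z > 1 \<Longrightarrow> f z = h z"
    and "Q \<subseteq> {1}" "s \<in> {z. b < Re z} - Q" "g holomorphic_on ({z. b < Re z} - Q)"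
    and g: "\<And>z. z \<in> {z. b < Re z} - Q \<Longrightarrow> Re z > 1 \<Longrightarrow> g z = h z"
  shows "f s = g s"
proof -
  define c where "c = max a b"
  define H where "H = {z. c < Re z}"
  define D where "D = H - (P \<union> Q)"
  define U where "U = H \<inter> {z. 1 < Re z}"
  have fin: "finite (P \<union> Q)"
    using assms(1,5) by (meson finite.emptyI finite.insertI finite_UnI finite_subset)
  have "open H" "convex H"
    by (simp_all add: H_def open_halfspace_Re_gt convex_halfspace_Re_gt)
  then have "open D"
    unfolding D_def using fin by (intro open_Diff finite_imp_closed)
  have "connected D"
    unfolding D_def using fin \<open>open H\<close> \<open>convex H\<close>
    by (intro connected_open_delete_finite convex_connected) auto
  have "open U"
    unfolding U_def using \<open>open H\<close> by (intro open_Int open_halfspace_Re_gt)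
  have "U \<subseteq> D"
    using assms(1,5) by (auto simp: U_def D_def)
  have "of_real (max c 1 + 1) \<in> U"
    by (auto simp: U_def H_def)
  have "s \<in> D"
    using assms(2,6) by (auto simp: D_def H_def c_def)
  have "D \<subseteq> {z. a < Re z} - P" "D \<subseteq> {z. b < Re z} - Q"
    by (auto simp: D_def H_def c_def)
  then have "f holomorphic_on D" "g holomorphic_on D"
    using assms(3,7) holomorphic_on_subset by blast+
  moreover have "f z = g z" if "z \<in> U" for z
    using that \<open>U \<subseteq> D\<close> f[of z] g[of z] by (force simp: D_def U_def H_def c_def)
  ultimately show ?thesis
    by (intro analytic_continuation_open[of U D f g s] \<open>open U\<close> \<open>open D\<close> \<open>connected D\<close>
        \<open>U \<subseteq> D\<close> \<open>s \<in> D\<close>) (use \<open>of_real (max c 1 + 1) \<in> U\<close> in auto)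
qed

lemma Dirichlet_L_eqI:
  assumes "P \<subseteq> {1}" "s \<in> {z. a < Re z} - P" "f holomorphic_on ({z. a < Re z} - P)"
    and "\<And>z. z \<in> {z. a < Re z} - P \<Longrightarrow> Re z > 1 \<Longrightarrow> f z = dirichlet_series X z"
  shows "Dirichlet_L s X = f s"
  unfolding Dirichlet_L_def
proof (rule the_equality)
  show "\<exists>a P g. P \<subseteq> {1} \<and> s \<in> {z. a < Re z} - P \<and> g holomorphic_on ({z. a < Re z} - P) \<and>
      (\<forall>z \<in> {z. a < Re z} - P. Re z > 1 \<longrightarrow> g z = dirichlet_series X z) \<and> f s = g s"
    by (rule exI[of _ a], rule exI[of _ P], rule exI[of _ f]) (intro conjI ballI impI assms refl)
next
  fix w
  assume "\<exists>a P g. P \<subseteq> {1} \<and> s \<in> {z. a < Re z} - P \<and> g holomorphic_on ({z. a < Re z} - P) \<and>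
      (\<forall>z \<in> {z. a < Re z} - P. Re z > 1 \<longrightarrow> g z = dirichlet_series X z) \<and> w = g s"
  then obtain b Q g where Q: "Q \<subseteq> {1}" and s: "s \<in> {z. b < Re z} - Q"
    and hol: "g holomorphic_on ({z. b < Re z} - Q)"
    and eq: "\<forall>z \<in> {z. b < Re z} - Q. Re z > 1 \<longrightarrow> g z = dirichlet_series X z"
    and w: "w = g s"
    by (elim exE conjE)
  have "g s = f s"
    by (rule halfplane_continuation_unique[OF Q s hol eq[rule_format] assms])
  with w show "w = f s"
    by simp
qed

end

theory Submission
  imports Defs "HOL-Number_Theory.Number_Theory"
begin

text \<open>
  A non-principal character sums to \<open>0\<close> over a full period, so its sum over any interval is at
  most \<open>q / 2\<close> in absolute value: an interval shorter than \<open>q\<close> or its complement in a period has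
  at most \<open>q / 2\<close> terms. Partial summation then makes the Dirichlet series converge locally
  uniformly on \<open>Re s > 0\<close>, and for \<open>s = 1 + it\<close> it bounds the tail after \<open>N\<close> terms by \<open>B / (N + 1)\<close> with
  \<open>B = q \<bar>s\<bar> / 2\<close>. For \<open>N = \<lfloor>B\<rfloor>\<close> the tail is at most \<open>1\<close>, and the first \<open>N\<close> terms contribute at
  most the harmonic number \<open>H\<^sub>N \<le> ln (N + 1) + \<gamma> < ln (2 (N + 1)) \<le> ln (q (t + 14 / 5))\<close>, because
  \<open>\<gamma> < ln 2\<close>, \<open>\<bar>s\<bar> \<le> 1 + t\<close> and \<open>q \<ge> 2\<close>.
\<close>

section \<open>Values of Dirichlet characters and their sum over a period\<close>

lemma dirichlet_character_one:
  assumes "dirichlet_character q X"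
  shows "X 1 = 1"
proof -
  have "X 1 \<noteq> 0" "X (1 * 1) = X 1 * X 1"
    using assms by (simp_all only: dirichlet_character_def coprime_1_left)
  then show ?thesis by simp
qed

lemma dirichlet_character_add_mult:
  assumes "dirichlet_character q X"
  shows "X (n + k * int q) = X n"
proof -
  have per: "X (m + int q) = X m" for m
    using assms by (simp add: dirichlet_character_def)
  show ?thesis
  proof (induction k rule: int_induct[where k = 0])
    case (step1 i)
    then show ?case using per[of "n + i * int q"] by (simp add: algebra_simps)
  next
    case (step2 i)
    then show ?case using per[of "n + (i - 1) * int q"] by (simp add: algebra_simps)
  qed simp
qed

lemma dirichlet_character_mod:
  assumes "dirichlet_character q X"
  shows "X (n mod int q) = X n"
  using dirichlet_character_add_mult[OF assms, of "n mod int q" "n div int q"]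
  by simp

lemma dirichlet_character_cong:
  assumes "dirichlet_character q X" "[m = n] (mod int q)"
  shows "X m = X n"
  using dirichlet_character_mod[OF assms(1)] assms(2) by (metis cong_def)

lemma dirichlet_character_power:
  assumes "dirichlet_character q X"
  shows "X (n ^ k) = X n ^ k"
proof (induction k)
  case 0
  then show ?case by (simp add: dirichlet_character_one[OF assms])
next
  case (Suc k)
  then show ?case using assms by (simp add: dirichlet_character_def)
qed

text \<open>By Euler's theorem \<open>X n\<close> is a root of unity when \<open>n\<close> is
  coprime to \<open>q\<close>; otherwise it vanishes.\<close>

lemma norm_dirichlet_character_le_1:
  assumes "dirichlet_character q X" "q \<ge> 1"
  shows "norm (X (int n)) \<le> 1"
proof (cases "coprime n q")
  case True
  from euler_theorem[OF True] have "[int n ^ totient q = 1] (mod int q)"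
    by (metis cong_int_iff of_nat_1 of_nat_power)
  from dirichlet_character_cong[OF assms(1) this] have "X (int n) ^ totient q = 1"
    by (simp add: dirichlet_character_power[OF assms(1)] dirichlet_character_one[OF assms(1)])
  then have "norm (X (int n)) ^ totient q = 1"
    by (metis norm_one norm_power)
  then show ?thesis
    using assms(2) by (auto dest: power_eq_1_iff[rotated])
next
  case False
  then have "X (int n) = 0"
    using assms(1) unfolding dirichlet_character_def by (metis coprime_int_iff)
  then show ?thesis by simp
qed

text \<open>Multiplication by a unit \<open>a\<close> with \<open>X a \<noteq> 1\<close> permutes
  the residues, so the period sum \<open>S\<close> satisfies \<open>S = X a * S\<close>.\<close>

lemma dirichlet_character_sum_eq_0:
  assumes "dirichlet_character q X" "q \<ge> 1" "X \<noteq> principal_character q"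
  shows "(\<Sum>n = 0..<q. X (int n)) = 0"
proof -
  from assms(3) obtain a where a: "X a \<noteq> principal_character q a"
    by blast
  \<comment> \<open>If \<open>a\<close> were not coprime to \<open>q\<close>, both characters would
    vanish there; so \<open>a\<close> is a unit and the principal value is 1.\<close>
  have cop: "coprime a (int q)" and "X a \<noteq> 1"
    using a assms(1) by (auto simp: principal_character_def dirichlet_character_def split: if_splits)
  define S where "S = (\<Sum>n\<in>{0..<int q}. X n)"
  have inj: "inj_on (\<lambda>n. a * n mod int q) {0..<int q}"
  proof (rule inj_onI)
    fix m n assume mn: "m \<in> {0..<int q}" "n \<in> {0..<int q}" "a * m mod int q = a * n mod int q"
    then have "[m = n] (mod int q)"
      using cop by (simp add: cong_mult_lcancel flip: cong_def)
    then show "m = n" using mn by (simp add: cong_def)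
  qed
  have "(\<lambda>n. a * n mod int q) ` {0..<int q} = {0..<int q}"
    by (intro endo_inj_surj inj) (use assms(2) in auto)
  then have "S = (\<Sum>n\<in>{0..<int q}. X (a * n mod int q))"
    unfolding S_def using sum.reindex[OF inj, of X] by simp
  also have "\<dots> = X a * S"
    using assms(1) by (simp add: dirichlet_character_mod S_def sum_distrib_left dirichlet_character_def)
  finally have "(1 - X a) * S = 0" by (simp add: algebra_simps)
  then have "S = 0" using \<open>X a \<noteq> 1\<close> by simp
  moreover have "S = (\<Sum>n = 0..<q. X (int n))"
    unfolding S_def by (rule sum.reindex_bij_witness[of _ int nat]) auto
  ultimately show ?thesis by simp
qed

section \<open>Character sums over intervals\<close>

lemma norm_sum_interval_periodic_le:
  fixes g :: "nat \<Rightarrow> complex"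
  assumes per: "\<And>n. g (n + q) = g n" and le: "\<And>n. norm (g n) \<le> 1"
    and zero: "(\<Sum>n = 0..<q. g n) = 0" and "q \<ge> 1"
  shows "norm (\<Sum>n = M..<N. g n) \<le> real q / 2"
proof -
  \<comment> \<open>Sliding the window by one drops \<open>g M\<close> and adds the equal term
    \<open>g (M + q)\<close>.\<close>
  have period: "(\<Sum>n = M..<M + q. g n) = 0" for M
  proof (induction M)
    case (Suc M)
    have "(\<Sum>n = Suc M..<Suc M + q. g n) = (\<Sum>n = M..<M + q. g n) - g M + g (M + q)"
      using \<open>q \<ge> 1\<close> by (simp add: sum.atLeast_Suc_lessThan)
    then show ?case using Suc per by simp
  qed (use zero in simp)
  have triv: "norm (\<Sum>n = M..<N. g n) \<le> real (N - M)" for M N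
    using sum_norm_bound[of "{M..<N}" g 1] le by simp
  show ?thesis
  proof (induction "N - M" arbitrary: M rule: less_induct)
    case less
    \<comment> \<open>A full period is peeled off a long interval. A short one has sum opposite to
      that of its complement \<open>{N..<M + q}\<close>; the two lengths add up to \<open>q\<close>,
      so one of the two trivial bounds is at most \<open>q / 2\<close>.\<close>
    consider "N \<ge> M + q" | "N \<le> M" | "M < N" "N < M + q" by linarith
    then show ?case
    proof cases
      case 1
      then have "(\<Sum>n = M..<N. g n) = (\<Sum>n = M + q..<N. g n)"
        using sum.atLeastLessThan_concat[of M "M + q" N g] period[of M] by simp
      then show ?thesis using less[of "M + q"] 1 \<open>q \<ge> 1\<close> by simp
    next
      case 3
      then have "(\<Sum>n = M..<N. g n) = - (\<Sum>n = N..<M + q. g n)"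
        using sum.atLeastLessThan_concat[of M N "M + q" g] period[of M]
        by (simp add: eq_neg_iff_add_eq_0)
      then have "norm (\<Sum>n = M..<N. g n) \<le> real (M + q - N)"
        using triv[of N "M + q"] by simp
      then show ?thesis using triv[of M N] 3 by (simp add: of_nat_diff)
    qed simp
  qed
qed

section \<open>Partial summation and convergence for \<open>Re z > 0\<close>\<close>

lemma norm_powr_diff_le:
  fixes x y :: real and z :: complex
  assumes "0 < x" "x \<le> y" "Re z > 0"
  shows "norm (of_real x powr - z - of_real y powr - z)
           \<le> norm z / Re z * (x powr - Re z - y powr - Re z)"
proof -
  \<comment> \<open>\<open>f\<close> is the derivative of \<open>u powr - z\<close>. Its norm is the
    \<open>h\<close> below, whose integral is a multiple of a difference of real powers, so that
    these bounds telescope when summed.\<close>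
  define f where "f = (\<lambda>u. - (z * complex_of_real u powr (- z - 1)))"
  have "((\<lambda>u. complex_of_real u powr - z) has_vector_derivative f u) (at u within {x..y})"
    if "u \<in> {x..y}" for u
    unfolding f_def using that assms
    by (auto intro!: derivative_eq_intros has_vector_derivative_real_field)
  then have F: "(f has_integral (of_real y powr - z - of_real x powr - z)) {x..y}"
    by (intro fundamental_theorem_of_calculus assms)
  define h where "h = (\<lambda>u. norm z * u powr (- Re z - 1))"
  have "((\<lambda>u. - (norm z / Re z) * u powr - Re z) has_real_derivative h u) (at u within {x..y})"
    if "u \<in> {x..y}" for u
    unfolding h_def using that assms
    by (auto intro!: derivative_eq_intros simp: field_simps)
  then have H: "(h has_integral (- (norm z / Re z) * y powr - Re z - - (norm z / Re z) * x powr - Re z)) {x..y}"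
    by (intro fundamental_theorem_of_calculus assms)
      (simp add: has_real_derivative_iff_has_vector_derivative)
  have "norm (integral {x..y} f) \<le> integral {x..y} h"
    using assms F H
    by (intro integral_norm_bound_integral)
      (auto simp: f_def h_def norm_mult norm_powr_real_powr has_integral_integrable)
  then show ?thesis
    using integral_unique[OF F] integral_unique[OF H]
    by (simp add: norm_minus_commute algebra_simps)
qed

lemma sum_by_parts:
  fixes g b :: "nat \<Rightarrow> 'a::comm_ring"
  assumes "M \<le> N"
  shows "(\<Sum>n = M..<N. g n * b n)
       = (\<Sum>n = M..<N. g n) * b N + (\<Sum>n = M..<N. (\<Sum>k = M..<Suc n. g k) * (b n - b (Suc n)))"
  using assms
proof (induction N rule: dec_induct)
  case (step N)
  then show ?case by (simp add: algebra_simps)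
qed simp

text \<open>Summation by parts, with the differences of \<open>of_nat (Suc n) powr - z\<close>
  replaced by a telescoping real majorant. The bound is free of \<open>N\<close>, so it serves both
  as a Cauchy criterion and as a tail estimate.\<close>

lemma norm_dirichlet_sum_le:
  fixes g :: "nat \<Rightarrow> complex"
  assumes C: "\<And>M N. norm (\<Sum>n = M..<N. g n) \<le> C" and z: "Re z > 0" and MN: "M \<le> N"
  shows "norm (\<Sum>n = M..<N. g n * of_nat (Suc n) powr - z)
           \<le> C * (norm z / Re z) * real (Suc M) powr - Re z"
proof -
  define b where "b = (\<lambda>n. complex_of_nat (Suc n) powr - z)"
  define r where "r = (\<lambda>n. real (Suc n) powr - Re z)"
  define K where "K = norm z / Re z"
  have C0: "C \<ge> 0" using C[of 0 0] by simp
  have K1: "K \<ge> 1" using complex_Re_le_cmod[of z] z by (simp add: K_def)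
  have nb: "norm (b n) = r n" for n
    unfolding b_def r_def using norm_powr_real_powr[of "of_nat (Suc n)" "- z"]
    by (simp del: of_nat_Suc)
  have db: "norm (b n - b (Suc n)) \<le> K * (r n - r (Suc n))" for n
    unfolding b_def r_def K_def
    using norm_powr_diff_le[of "real (Suc n)" "real (Suc (Suc n))" z] z by (simp del: of_nat_Suc)
  have "norm (\<Sum>n = M..<N. g n * b n)
      \<le> norm (\<Sum>n = M..<N. g n) * norm (b N)
        + (\<Sum>n = M..<N. norm (\<Sum>k = M..<Suc n. g k) * norm (b n - b (Suc n)))"
    by (subst sum_by_parts[OF MN], rule order_trans[OF norm_triangle_ineq], intro add_mono sum_norm_le) (simp_all add: norm_mult)
  also have "\<dots> \<le> C * r N + (\<Sum>n = M..<N. C * (K * (r n - r (Suc n))))"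
    using C0 K1 by (intro add_mono sum_mono mult_mono C db) (auto simp: nb r_def)
  also have "(\<Sum>n = M..<N. C * (K * (r n - r (Suc n)))) = C * K * (r M - r N)"
    using sum_Suc_diff'[OF MN, of "\<lambda>n. - r n"] by (simp add: sum_distrib_left[symmetric] mult.assoc)
  \<comment> \<open>Since \<open>K \<ge> 1\<close>, the telescoped sum already pays for the boundary
    term \<open>C * r N\<close>.\<close>
  also have "C * r N + C * K * (r M - r N) = C * K * r M - C * r N * (K - 1)"
    by (simp add: algebra_simps)
  also have "\<dots> \<le> C * K * r M"
    using C0 K1 by (simp add: r_def)
  finally show ?thesis by (simp add: b_def r_def K_def)
qed

lemma dirichlet_sum_uniform_limit:
  fixes g :: "nat \<Rightarrow> complex"
  assumes C: "\<And>M N. norm (\<Sum>n = M..<N. g n) \<le> C" and "\<delta> > 0"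
    and A: "\<And>z. z \<in> A \<Longrightarrow> Re z \<ge> \<delta>" "\<And>z. z \<in> A \<Longrightarrow> norm z \<le> R"
  shows "uniform_limit A (\<lambda>N z. \<Sum>n<N. g n * of_nat (Suc n) powr - z)
           (\<lambda>z. \<Sum>n. g n * of_nat (Suc n) powr - z) sequentially"
proof -
  let ?S = "\<lambda>N z. \<Sum>n<N. g n * of_nat (Suc n) powr - z"
  have C0: "C \<ge> 0" using C[of 0 0] by simp
  have lim: "(\<lambda>M. C * (R / \<delta>) * real (Suc M) powr - \<delta>) \<longlonglongrightarrow> 0"
    using \<open>\<delta> > 0\<close> by real_asymp
  have "uniformly_Cauchy_on A ?S"
  proof (rule uniformly_Cauchy_onI')
    fix e :: real assume "e > 0"
    then obtain M0 where M0: "\<And>M. M \<ge> M0 \<Longrightarrow> C * (R / \<delta>) * real (Suc M) powr - \<delta> < e"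
      using order_tendstoD(2)[OF lim, of e] by (auto simp: eventually_sequentially)
    show "\<exists>M. \<forall>x\<in>A. \<forall>m\<ge>M. \<forall>n>m. dist (?S m x) (?S n x) < e"
    proof (intro exI[of _ M0] ballI allI impI)
      fix z m n assume z: "z \<in> A" and mn: "m \<ge> M0" "(n::nat) > m"
      have Rez: "Re z > 0" using A(1)[OF z] \<open>\<delta> > 0\<close> by simp
      have "?S n z - ?S m z = (\<Sum>n = m..<n. g n * of_nat (Suc n) powr - z)"
        using mn sum_diff_nat_ivl[of 0 m n "\<lambda>n. g n * of_nat (Suc n) powr - z"]
        by (simp add: lessThan_atLeast0)
      then have "dist (?S m z) (?S n z) = norm (\<Sum>n = m..<n. g n * of_nat (Suc n) powr - z)"
        by (subst dist_commute) (simp only: dist_norm)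
      also have "\<dots> \<le> C * (norm z / Re z) * real (Suc m) powr - Re z"
        using mn by (intro norm_dirichlet_sum_le C Rez) simp
      \<comment> \<open>The bounds on \<open>A\<close> make the estimate independent of
        \<open>z\<close>; the base \<open>Suc m\<close> is at least 1, so lowering
        \<open>Re z\<close> to \<open>\<delta>\<close> only increases the power.\<close>
      also have "\<dots> \<le> C * (R / \<delta>) * real (Suc m) powr - \<delta>"
        using A[OF z] C0 \<open>\<delta> > 0\<close> Rez order_trans[OF norm_ge_zero A(2)[OF z]]
        by (intro mult_mono frac_le powr_mono) auto
      also have "\<dots> < e" using M0 mn by blast
      finally show "dist (?S m z) (?S n z) < e" .
    qed
  qed
  from Cauchy_uniformly_convergent[OF this] have "uniform_limit A ?S (\<lambda>z. lim (\<lambda>N. ?S N z)) sequentially"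
    by (simp add: uniformly_convergent_uniform_limit_iff)
  then show ?thesis by (simp add: suminf_eq_lim)
qed

lemma dirichlet_sum_holomorphic:
  fixes g :: "nat \<Rightarrow> complex"
  assumes C: "\<And>M N. norm (\<Sum>n = M..<N. g n) \<le> C"
  shows "(\<lambda>z. \<Sum>n. g n * of_nat (Suc n) powr - z) holomorphic_on {z. Re z > 0}"
proof (rule holomorphic_uniform_sequence)
  show "open {z. Re z > 0}" by (rule open_halfspace_Re_gt)
  show "(\<lambda>z. \<Sum>n<N. g n * of_nat (Suc n) powr - z) holomorphic_on {z. Re z > 0}" for N
    by (intro holomorphic_intros)
  fix z :: complex assume z: "z \<in> {z. Re z > 0}"
  have Re: "Re w \<ge> Re z / 2" if "w \<in> cball z (Re z / 2)" for w
    using that abs_Re_le_cmod[of "z - w"] by (simp add: dist_norm)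
  have nm: "norm w \<le> norm z + Re z / 2" if "w \<in> cball z (Re z / 2)" for w
    using that norm_triangle_ineq2[of w z] by (simp add: dist_norm norm_minus_commute)
  show "\<exists>d>0. cball z d \<subseteq> {z. Re z > 0} \<and>
      uniform_limit (cball z d) (\<lambda>N z. \<Sum>n<N. g n * of_nat (Suc n) powr - z)
        (\<lambda>z. \<Sum>n. g n * of_nat (Suc n) powr - z) sequentially"
  \<comment> \<open>On this disc \<open>Re z / 2\<close> serves as \<open>\<delta>\<close> and
    \<open>norm z + Re z / 2\<close> as \<open>R\<close>.\<close>
  proof (intro exI[of _ "Re z / 2"] conjI)
    show "cball z (Re z / 2) \<subseteq> {z. Re z > 0}"
      using Re z by fastforce
    show "uniform_limit (cball z (Re z / 2)) (\<lambda>N z. \<Sum>n<N. g n * of_nat (Suc n) powr - z)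
        (\<lambda>z. \<Sum>n. g n * of_nat (Suc n) powr - z) sequentially"
      using z by (intro dirichlet_sum_uniform_limit[OF C _ Re nm]) auto
  qed (use z in simp)
qed

text \<open>The bound on the sum over \<open>M..<N\<close> survives the limit in
  \<open>N\<close>.\<close>

lemma norm_dirichlet_sum_tail_le:
  fixes g :: "nat \<Rightarrow> complex"
  assumes C: "\<And>M N. norm (\<Sum>n = M..<N. g n) \<le> C" and z: "Re z > 0"
  shows "norm ((\<Sum>n. g n * of_nat (Suc n) powr - z) - (\<Sum>n<M. g n * of_nat (Suc n) powr - z))
           \<le> C * (norm z / Re z) * real (Suc M) powr - Re z"
proof -
  let ?a = "\<lambda>n. g n * of_nat (Suc n) powr - z"
  have lim: "(\<lambda>N. \<Sum>n<N. ?a n) \<longlonglongrightarrow> (\<Sum>n. ?a n)"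
    using tendsto_uniform_limitI[OF dirichlet_sum_uniform_limit[OF C z, of "{z}" "norm z"], of z]
    by simp
  show ?thesis
  proof (rule tendsto_upperbound[OF tendsto_norm[OF tendsto_diff[OF lim tendsto_const]]])
    show "\<forall>\<^sub>F N in sequentially. norm ((\<Sum>n<N. ?a n) - (\<Sum>n<M. ?a n))
        \<le> C * (norm z / Re z) * real (Suc M) powr - Re z"
      using eventually_ge_at_top[of M]
    proof eventually_elim
      case (elim N)
      have "(\<Sum>n<N. ?a n) - (\<Sum>n<M. ?a n) = (\<Sum>n = M..<N. ?a n)"
        using elim sum_diff_nat_ivl[of 0 M N ?a] by (simp add: lessThan_atLeast0)
      then show ?case using norm_dirichlet_sum_le[OF C z elim] by simp
    qed
  qed simp
qed

section \<open>Harmonic numbers and the estimate at \<open>1 + it\<close>\<close>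

lemma harm_le_ln_plus_euler_mascheroni:
  "harm n \<le> ln (real (Suc n)) + (euler_mascheroni :: real)"
\<comment> \<open>The lower bound for \<open>euler_mascheroni\<close> starts at
  \<open>harm 1\<close> and carries an extra positive term, which is discarded; \<open>n = 0\<close>
  needs only \<open>euler_mascheroni > 0\<close>.\<close>
proof (cases n)
  case 0
  then show ?thesis using euler_mascheroni_pos by (simp add: harm_def)
next
  case (Suc m)
  have "0 \<le> 1 / real (2 * (m + 2))" by simp
  then have "harm (Suc m) \<le> ln (real (m + 2)) + (euler_mascheroni :: real)"
    using euler_mascheroni_lower[of m] by linarith
  then show ?thesis by (simp add: Suc add_ac)
qed

theorem theorem2:
  fixes q :: nat and X :: "int \<Rightarrow> complex" and t :: real
  assumes "q \<ge> 1"
    and "dirichlet_character q X"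
    and "X \<noteq> principal_character q"
    and "t > 0"
  shows "cmod (Dirichlet_L (1 + \<i> * of_real t) X) < ln (t + 14 / 5) + ln (real q) + 1"
proof -
  define g where "g = (\<lambda>n. X (int (Suc n)))"
  define s where "s = 1 + \<i> * complex_of_real t"
  define B where "B = real q / 2 * norm s"
  define N where "N = nat \<lfloor>B\<rfloor>"
  \<comment> \<open>Modulo 1 all integers are congruent, so the only character is principal.\<close>
  have "q \<noteq> 1"
  proof
    assume "q = 1"
    then have "X n = X 1" for n
      by (intro dirichlet_character_cong[OF assms(2)]) (simp add: cong_def)
    then have "X n = principal_character q n" for n
      by (metis \<open>q = 1\<close> dirichlet_character_one[OF assms(2)] principal_character_def of_nat_1 coprime_1_right)
    with assms(3) show False by blast
  qed
  with assms(1) have q2: "real q \<ge> 2" by simp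
  have le1: "norm (X (int n)) \<le> 1" for n
    using norm_dirichlet_character_le_1 assms(1,2) by blast
  have C: "norm (\<Sum>n = M..<N. g n) \<le> real q / 2" for M N
  proof -
    have "X (int (n + q)) = X (int n)" for n
      using assms(2) by (simp add: dirichlet_character_def)
    \<comment> \<open>Index \<open>n\<close> of \<open>g\<close> stands for the integer
      \<open>n + 1\<close>, hence the shifted interval.\<close>
    then have "norm (\<Sum>n = Suc M..<Suc N. X (int n)) \<le> real q / 2"
      by (intro norm_sum_interval_periodic_le le1 dirichlet_character_sum_eq_0 assms)
    then show ?thesis
      by (simp only: g_def sum.atLeast_Suc_lessThan_Suc_shift o_def)
  qed
  have Res: "Re s = 1" by (simp add: s_def)
  have L: "Dirichlet_L s X = dirichlet_series X s"
  \<comment> \<open>The series itself is the continuation to \<open>Re z > 0\<close>, and there is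
    no pole at 1 to remove.\<close>
  proof (rule Dirichlet_L_eqI[where P = "{}" and a = 0])
    show "dirichlet_series X holomorphic_on {z. 0 < Re z} - {}"
      using dirichlet_sum_holomorphic[OF C] by (simp add: g_def dirichlet_series_def[abs_def])
  qed (auto simp: Res)
  have "norm s \<le> norm (1::complex) + norm (\<i> * complex_of_real t)"
    unfolding s_def by (rule norm_triangle_ineq)
  then have ns: "norm s \<le> 1 + t" using assms(4) by (simp add: norm_mult)
  have B0: "B \<ge> 0" by (simp add: B_def)
  have NB: "real N \<le> B" "B \<le> real (Suc N)" unfolding N_def using B0 by linarith+
  have "norm (\<Sum>n<N. g n * of_nat (Suc n) powr - s) \<le> (\<Sum>n<N. inverse (real (Suc n)))"
  proof (rule sum_norm_le)
    fix n
    have "norm (complex_of_nat (Suc n) powr - s) = inverse (real (Suc n))"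
      using norm_powr_real_powr[of "of_nat (Suc n)" "- s"] by (simp add: Res powr_minus)
    then show "norm (g n * of_nat (Suc n) powr - s) \<le> inverse (real (Suc n))"
      using le1[of "Suc n"] by (simp only: norm_mult g_def) (simp add: mult_left_le_one_le)
  qed
  also have "\<dots> = harm N" by (simp add: harm_altdef)
  also have "\<dots> \<le> ln (real (Suc N)) + euler_mascheroni"
    by (rule harm_le_ln_plus_euler_mascheroni)
  \<comment> \<open>This gives the strict inequality:
    \<open>euler_mascheroni < 13 / 22 < 2 / 3 \<le> ln 2\<close>.\<close>
  also have "\<dots> < ln (real (Suc N)) + ln 2"
    using euler_mascheroni_less_13_over_22 ln2_ge_two_thirds by linarith
  also have "\<dots> = ln (2 * real (Suc N))" by (subst ln_mult) simp_all
  also have "\<dots> \<le> ln (real q * (t + 14 / 5))"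
  proof -
    have "2 * B \<le> real q * (1 + t)" using ns by (simp add: B_def mult_left_mono)
    \<comment> \<open>The left side is at most \<open>2 * B + 2 \<le> q * (1 + t) + 2\<close>, and
      \<open>2 \<le> q * 9 / 5\<close> because \<open>q \<ge> 2\<close>.\<close>
    then have "2 * real (Suc N) \<le> real q * (t + 14 / 5)"
      using NB(1) q2 by (simp add: algebra_simps)
    then show ?thesis by simp
  qed
  also have "\<dots> = ln (t + 14 / 5) + ln (real q)"
    using assms(4) q2 by (subst ln_mult) simp_all
  finally have head: "norm (\<Sum>n<N. g n * of_nat (Suc n) powr - s) < ln (t + 14 / 5) + ln (real q)" .
  have "norm (dirichlet_series X s - (\<Sum>n<N. g n * of_nat (Suc n) powr - s)) \<le> B / real (Suc N)"
    using norm_dirichlet_sum_tail_le[OF C, of s N]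
    by (simp add: Res g_def dirichlet_series_def B_def powr_minus_divide)
  also have "\<dots> \<le> 1" using NB(2) by simp
  finally have "norm (dirichlet_series X s) < ln (t + 14 / 5) + ln (real q) + 1"
    using head norm_triangle_sub[of "dirichlet_series X s" "\<Sum>n<N. g n * of_nat (Suc n) powr - s"]
    by linarith
  then show ?thesis using L by (simp add: s_def)
qed

end
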